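(* Let $(a_{n,m}),(b_{n,m}),(c_{n,m}),(d_{n,m})$, $n,m\in\mathbb{Z}_+$, be arrays of complex numbers with $a_{0,m}=0$ for all $m\ge 0$ and $b_{n,0}=0$ for all $n\ge 0$. The following are equivalent. (A) There is a family of invertible matrices $$L_{n,m}(x)=\begin{pmatrix} x+\alpha^{(1)}_{n,m}&\alpha^{(2)}_{n,m}&\alpha^{(3)}_{n,m}\\ \alpha^{(4)}_{n+1,m}&0&0\\ \alpha^{(5)}_{n+1,m}&0&1\end{pmatrix},\qquad M_{n,m}(x)=\begin{pmatrix} x+\beta^{(1)}_{n,m}&\alpha^{(2)}_{n,m}&\alpha^{(3)}_{n,m}\\ \alpha^{(4)}_{n,m+1}&1&0\\ \alpha^{(5)}_{n,m+1}&0&0\end{pmatrix},\qquad n,m\in\mathbb{Z}_+,$$ with complex $\alpha^{(i)}_{n,m}$ ($1\le i\le 5$) and $\beta^{(1)}_{n,m}$ satisfying $$c_{n,m}=-\alpha^{(1)}_{n,m},\quad d_{n,m}=-\beta^{(1)}_{n,m},\quad a_{n,m}=-\alpha^{(4)}_{n,m}\alpha^{(2)}_{n,m},\quad b_{n,m}=-\alpha^{(5)}_{n,m}\alpha^{(3)}_{n,m},$$ for which the zero curvature condition $$L_{n,m+1}(x)M_{n,m}(x)-M_{n+1,m}(x)L_{n,m}(x)=0,\qquad n,m\in\mathbb{Z}_+,\ x\in\mathbb{C},$$ holds. (B) There is a perfect system $(f_1,f_2)$ whose monic Hermite-Padé polynomials $P_{n,m}$ satisfy, for all $n,m\ge 0$,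 $$P_{n+1,m}(x)=(x-c_{n,m})P_{n,m}(x)-a_{n,m}P_{n-1,m}(x)-b_{n,m}P_{n,m-1}(x),$$ $$P_{n,m+1}(x)=(x-d_{n,m})P_{n,m}(x)-a_{n,m}P_{n-1,m}(x)-b_{n,m}P_{n,m-1}(x),$$ with $a_{n,m}\ne 0$ for $n\ge 1,\ m\ge 0$ and $b_{n,m}\neq 0$ for $n\ge 0,\ m\ge 1$.
   Context: $\mathbb{Z}_+=\{0,1,2,\dots\}$. Let $f_j(z)=\sum_{k\ge 0}s_{j,k}z^{-k-1}$, $j=1,2$, be (formal) Laurent series at infinity with complex coefficients. For $(n_1,n_2)\in\mathbb{Z}_+^2$, a (type II) Hermite-Padé polynomial for $(f_1,f_2)$ is a nonzero polynomial $P_{n_1,n_2}$ with $\deg P_{n_1,n_2}\le n_1+n_2$ such that for $j=1,2$ there is a polynomial $Q^{(j)}$ with $f_j(z)P_{n_1,n_2}(z)-Q^{(j)}(z)=\mathcal{O}(z^{-n_j-1})$ as $z\to\infty$. The index $(n_1,n_2)$ is normal if $P_{n_1,n_2}$ is unique up to a multiplicative constant and every nontrivial solution has full degree $n_1+n_2$; then $P_{n_1,n_2}$ is normalized to be monic. The system $(f_1,f_2)$ is perfect if all indices $(n_1,n_2)\in\mathbb{Z}_+^2$ are normal. In the recurrence relations, terms with coefficient $a_{0,m}=0$ or $b_{n,0}=0$ are understood to be absent. *)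

theory Defs
  imports "HOL-Analysis.Analysis" "HOL-Computational_Algebra.Formal_Laurent_Series"
begin

text \<open>
  A formal Laurent series at infinity is a \<^typ>\<open>complex fls\<close> whose variable stands for \<open>1/z\<close>:
  the coefficient of \<open>z^(-i)\<close> is \<open>fls_nth F i\<close>, and the polynomial variable \<open>z\<close> is
  \<^const>\<open>fls_X_inv\<close>.
\<close>

definition series_at_infinity :: "(nat \<Rightarrow> complex) \<Rightarrow> complex fls" where
  "series_at_infinity s = fps_to_fls (fps_X * Abs_fps s)"

definition poly_at_infinity :: "complex poly \<Rightarrow> complex fls" where
  "poly_at_infinity p = poly (map_poly fls_const p) fls_X_inv"

text \<open>\<open>big_o_at_infinity F k\<close> is the formal statement \<open>F(z) = O(z^(-k))\<close> as \<open>z\<close> tends to infinity.\<close>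

definition big_o_at_infinity :: "complex fls \<Rightarrow> nat \<Rightarrow> bool" where
  "big_o_at_infinity F k \<longleftrightarrow> (\<forall>i < int k. fls_nth F i = 0)"

definition hermite_pade ::
  "complex fls \<Rightarrow> complex fls \<Rightarrow> nat \<Rightarrow> nat \<Rightarrow> complex poly \<Rightarrow> bool" where
  "hermite_pade f1 f2 n1 n2 P \<longleftrightarrow>
     P \<noteq> 0 \<and> degree P \<le> n1 + n2 \<and>
     (\<exists>Q. big_o_at_infinity (f1 * poly_at_infinity P - poly_at_infinity Q) (n1 + 1)) \<and>
     (\<exists>Q. big_o_at_infinity (f2 * poly_at_infinity P - poly_at_infinity Q) (n2 + 1))"

text \<open>
  The existence clause is automatic: one has \<open>n1 + n2\<close> homogeneous linear equations for the
  \<open>n1 + n2 + 1\<close> coefficients of \<open>P\<close>.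
\<close>

definition normal_index :: "complex fls \<Rightarrow> complex fls \<Rightarrow> nat \<Rightarrow> nat \<Rightarrow> bool" where
  "normal_index f1 f2 n1 n2 \<longleftrightarrow>
     (\<exists>P. hermite_pade f1 f2 n1 n2 P) \<and>
     (\<forall>P Q. hermite_pade f1 f2 n1 n2 P \<and> hermite_pade f1 f2 n1 n2 Q \<longrightarrow> (\<exists>k. Q = smult k P)) \<and>
     (\<forall>P. hermite_pade f1 f2 n1 n2 P \<longrightarrow> degree P = n1 + n2)"

definition perfect_system :: "complex fls \<Rightarrow> complex fls \<Rightarrow> bool" where
  "perfect_system f1 f2 \<longleftrightarrow> (\<forall>n1 n2. normal_index f1 f2 n1 n2)"

text \<open>In the matrices, \<open>\<alpha> i n m\<close> is the entry with upper index \<open>(i)\<close>, for \<open>i\<close> from 1 to 5.\<close>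

definition L_mat ::
  "(nat \<Rightarrow> nat \<Rightarrow> nat \<Rightarrow> complex) \<Rightarrow> nat \<Rightarrow> nat \<Rightarrow> complex \<Rightarrow> complex^3^3" where
  "L_mat \<alpha> n m x = vector
     [vector [x + \<alpha> 1 n m,   \<alpha> 2 n m, \<alpha> 3 n m],
      vector [\<alpha> 4 (n + 1) m, 0,       0      ],
      vector [\<alpha> 5 (n + 1) m, 0,       1      ]]"

definition M_mat ::
  "(nat \<Rightarrow> nat \<Rightarrow> nat \<Rightarrow> complex) \<Rightarrow> (nat \<Rightarrow> nat \<Rightarrow> complex) \<Rightarrow>
    nat \<Rightarrow> nat \<Rightarrow> complex \<Rightarrow> complex^3^3" where
  "M_mat \<alpha> \<beta> n m x = vector
     [vector [x + \<beta> n m,     \<alpha> 2 n m, \<alpha> 3 n m],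
      vector [\<alpha> 4 n (m + 1), 1,       0      ],
      vector [\<alpha> 5 n (m + 1), 0,       0      ]]"

text \<open>
  The predecessor on \<^typ>\<open>nat\<close> is truncated (\<open>0 - 1 = 0\<close>); this is harmless because the
  recurrences are used only with \<open>a 0 m = 0\<close> and \<open>b n 0 = 0\<close>, so that the terms with an
  index \<open>-1\<close> vanish.
\<close>

definition nearest_neighbour_recurrences ::
  "(nat \<Rightarrow> nat \<Rightarrow> complex) \<Rightarrow> (nat \<Rightarrow> nat \<Rightarrow> complex) \<Rightarrow>
   (nat \<Rightarrow> nat \<Rightarrow> complex) \<Rightarrow> (nat \<Rightarrow> nat \<Rightarrow> complex) \<Rightarrow>
   (nat \<Rightarrow> nat \<Rightarrow> complex poly) \<Rightarrow> bool" where
  "nearest_neighbour_recurrences a b c d P \<longleftrightarrow>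
     (\<forall>n m x.
        poly (P (n + 1) m) x = (x - c n m) * poly (P n m) x
          - a n m * poly (P (n - 1) m) x - b n m * poly (P n (m - 1)) x \<and>
        poly (P n (m + 1)) x = (x - d n m) * poly (P n m) x
          - a n m * poly (P (n - 1) m) x - b n m * poly (P n (m - 1)) x)"

end

theory Submission
  imports Defs
begin

text \<open>
  Both sides are equivalent to a system of algebraic relations between the four arrays, called
  \<open>compatible\<close> below. With \<open>\<delta> n m = c n m - d n m\<close> it says that \<open>\<delta>\<close> never vanishes, that \<open>a\<close> and
  \<open>b\<close> vanish only where they are forced to, and that
  \<^item> \<open>c n (m+1) - c n m = d (n+1) m - d n m\<close>,
  \<^item> \<open>a (n+1) m + b (n+1) m - a n (m+1) - b n (m+1) = \<delta> n m * (c n (m+1) - c n m)\<close>,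
  \<^item> \<open>a n (m+1) * \<delta> (n-1) m = a n m * \<delta> n m\<close> for \<open>n \<ge> 1\<close>, and
    \<open>b (n+1) m * \<delta> n (m-1) = b n m * \<delta> n m\<close> for \<open>m \<ge> 1\<close>.

  For the zero curvature condition this is an entrywise computation: the determinants of the
  matrices are \<open>- \<alpha>\<^sub>2 \<alpha>\<^sub>4\<close> and \<open>- \<alpha>\<^sub>3 \<alpha>\<^sub>5\<close> up to shifts, and the off-diagonal entries of the
  matrix equation say that \<open>\<alpha>\<^sub>2\<close>, \<open>\<alpha>\<^sub>4\<close> (and \<open>\<alpha>\<^sub>3\<close>, \<open>\<alpha>\<^sub>5\<close>) change by factors \<open>\<plusminus>\<delta>\<close> along one
  lattice direction. Conversely these first order relations are solved by products of \<open>\<plusminus>\<delta>\<close>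
  (\<open>zero_curvature_iff_compatible\<close>).

  For the polynomials the key is the difference of the two recurrences,
  \<open>P n (m+1) = P (n+1) m + \<delta> n m * P n m\<close>, called the diagonal step below. Given
  the recurrence at height \<open>m\<close>, it expresses the failure of the recurrence at \<open>(n, m+1)\<close> as an
  explicit combination of four polynomials, whose coefficients are exactly the differences of the
  two sides in the displayed relations (\<open>recurrence_defect\<close>).

  If the relations hold, the diagonal step starting from the row \<open>m = 0\<close> therefore defines
  polynomials that satisfy both recurrences. Favard's theorem on the row \<open>m = 0\<close> and on the column
  \<open>n = 0\<close> provides two moment sequences. The diagonal step carries orthogonality from the row, and
  from the column, to the whole lattice; because \<open>\<delta>\<close> has no zero it also keeps the first moment
  that need not vanish different from zero (\<open>orthogonal_on_grid\<close>). These nonzero moments give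
  uniqueness by induction on the degree, that is, perfectness (\<open>perfect_system_if_orthogonal\<close>).

  If a perfect system is given, \<open>\<delta> n m = 0\<close> would make \<open>P n (m+1) = P (n+1) m\<close> a solution of
  too small degree for the index \<open>(n+1, m+1)\<close>. The four polynomials in the defect are then linearly
  independent, except at the boundary of the lattice, where coefficients vanish instead, so that
  the relations follow (\<open>recurrences_imp_compatible\<close>).
\<close>

section \<open>Hermite-Pade polynomials as orthogonal polynomials\<close>

text \<open>
  The value at \<open>x^k * p\<close> of the linear functional \<open>x^i \<mapsto> s i\<close>. The shift \<open>k\<close> is an argument
  because multiplication by \<open>x\<close> then becomes \<open>k \<mapsto> Suc k\<close>, as \<open>moment_pCons\<close> shows.
\<close>

definition moment :: "(nat \<Rightarrow> complex) \<Rightarrow> nat \<Rightarrow> complex poly \<Rightarrow> complex" where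
  "moment s k p = (\<Sum>i\<le>degree p. coeff p i * s (k + i))"

lemma moment_eq_sum:
  assumes "degree p \<le> N"
  shows "moment s k p = (\<Sum>i\<le>N. coeff p i * s (k + i))"
  unfolding moment_def using assms
  by (intro sum.mono_neutral_left) (auto simp: coeff_eq_0)

lemma moment_0 [simp]: "moment s k 0 = 0"
  by (simp add: moment_def)

lemma moment_smult [simp]: "moment s k (smult a p) = a * moment s k p"
  by (subst moment_eq_sum[OF degree_smult_le])
     (simp add: moment_def sum_distrib_left mult.assoc)

lemma moment_add [simp]: "moment s k (p + q) = moment s k p + moment s k q"
proof -
  let ?N = "max (degree p) (degree q)"
  have "moment s k (p + q) = (\<Sum>i\<le>?N. coeff (p + q) i * s (k + i))"
    by (rule moment_eq_sum) (rule degree_add_le_max)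
  then show ?thesis
    by (simp add: moment_eq_sum[of p ?N] moment_eq_sum[of q ?N] sum.distrib distrib_right)
qed

lemma moment_pCons [simp]: "moment s k (pCons a p) = a * s k + moment s (Suc k) p"
proof -
  have "degree (pCons a p) \<le> Suc (degree p)"
    by (rule degree_pCons_le)
  then show ?thesis
    by (simp add: moment_eq_sum[of "pCons a p"] sum.atMost_Suc_shift moment_def
             del: sum.atMost_Suc)
qed

lemma moment_diff [simp]: "moment s k (p - q) = moment s k p - moment s k q"
  using moment_add[of s k p "- q"] moment_smult[of s k "- 1" q] by simp

text \<open>
  This Horner step lets products with polynomials be computed by induction on the
  polynomial: multiplication by \<open>z\<close> is an index shift of the Laurent series.
\<close>

lemma poly_at_infinity_pCons:
  "poly_at_infinity (pCons a p) = fls_const a + fls_X_inv * poly_at_infinity p"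
  by (cases "a = 0 \<and> p = 0") (auto simp: poly_at_infinity_def map_poly_pCons)

lemma fls_nth_poly_at_infinity:
  "fls_nth (poly_at_infinity p) i = (if i \<le> 0 then coeff p (nat (- i)) else 0)"
proof (induction p arbitrary: i)
  case 0
  then show ?case by (simp add: poly_at_infinity_def)
next
  case (pCons a p)
  show ?case
  proof (cases "i < 0")
    case True
    then have "nat (- i) = Suc (nat (- (i + 1)))" by simp
    with True show ?thesis
      by (simp add: poly_at_infinity_pCons fls_X_inv_times_conv_shift pCons.IH)
  next
    case False
    then show ?thesis
      by (auto simp: poly_at_infinity_pCons fls_X_inv_times_conv_shift pCons.IH)
  qed
qed

lemma fls_nth_series_times_poly:
  "fls_nth (series_at_infinity s * poly_at_infinity p) (int k + 1) = moment s k p"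
proof (induction p arbitrary: k)
  case 0
  then show ?case by (simp add: poly_at_infinity_def)
next
  case (pCons a p)
  let ?F = "series_at_infinity s"
  have F: "fls_nth ?F (int k + 1) = s k"
    by (simp add: series_at_infinity_def nat_add_distrib)
  have "?F * poly_at_infinity (pCons a p)
      = fls_const a * ?F + fls_X_inv * (?F * poly_at_infinity p)"
    by (simp add: poly_at_infinity_pCons algebra_simps)
  then show ?case
    using pCons.IH[of "Suc k"] F
    by (simp add: fls_X_inv_times_conv_shift add.commute add.left_commute)
qed

text \<open>
  A suitable \<open>Q\<close> is the polynomial part of the series, which is finite because the series has
  only finitely many positive powers of \<open>z\<close>. What remains are the coefficients of
  \<open>z^(-1), \<dots>, z^(-n)\<close>, which no polynomial can change.
\<close>

lemma approximable_by_polynomial_iff: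
  "(\<exists>Q. big_o_at_infinity (F - poly_at_infinity Q) (n + 1)) \<longleftrightarrow>
   (\<forall>k<n. fls_nth F (int k + 1) = 0)"
proof
  assume "\<exists>Q. big_o_at_infinity (F - poly_at_infinity Q) (n + 1)"
  then show "\<forall>k<n. fls_nth F (int k + 1) = 0"
    by (auto simp: big_o_at_infinity_def fls_nth_poly_at_infinity)
next
  assume van: "\<forall>k<n. fls_nth F (int k + 1) = 0"
  define N where "N = nat (- fls_subdegree F)"
  define Q where "Q = (\<Sum>j\<le>N. monom (fls_nth F (- int j)) j)"
  have Q: "coeff Q j = fls_nth F (- int j)" for j
  proof (cases "j \<le> N")
    case True
    then show ?thesis by (simp add: Q_def coeff_sum)
  next
    case False
    then have "- int j < fls_subdegree F" by (simp add: N_def)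
    with False show ?thesis by (simp add: Q_def coeff_sum)
  qed
  have "fls_nth (F - poly_at_infinity Q) i = 0" if "i < int (n + 1)" for i
  proof (cases "i \<le> 0")
    case True
    then show ?thesis by (simp add: fls_nth_poly_at_infinity Q)
  next
    case False
    with that have "nat (i - 1) < n" "int (nat (i - 1)) + 1 = i" by auto
    with van have "fls_nth F i = 0" by metis
    with False show ?thesis by (simp add: fls_nth_poly_at_infinity)
  qed
  then show "\<exists>Q. big_o_at_infinity (F - poly_at_infinity Q) (n + 1)"
    unfolding big_o_at_infinity_def by blast
qed

lemma hermite_pade_iff_orthogonal:
  "hermite_pade (series_at_infinity s1) (series_at_infinity s2) n m P \<longleftrightarrow>
     P \<noteq> 0 \<and> degree P \<le> n + m \<and>
     (\<forall>k<n. moment s1 k P = 0) \<and> (\<forall>k<m. moment s2 k P = 0)"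
  unfolding hermite_pade_def approximable_by_polynomial_iff fls_nth_series_times_poly ..

section \<open>Zero curvature and the compatibility relations\<close>

text \<open>
  The discrete integrability conditions for nearest neighbour recurrences. The two relations for
  \<open>a\<close> and \<open>b\<close> are written with shifted indices, so that no predecessor occurs.
\<close>

definition compatible ::
  "(nat \<Rightarrow> nat \<Rightarrow> complex) \<Rightarrow> (nat \<Rightarrow> nat \<Rightarrow> complex) \<Rightarrow>
   (nat \<Rightarrow> nat \<Rightarrow> complex) \<Rightarrow> (nat \<Rightarrow> nat \<Rightarrow> complex) \<Rightarrow> bool" where
  "compatible a b c d \<longleftrightarrow>
     (\<forall>n m. c n m \<noteq> d n m \<and> a (Suc n) m \<noteq> 0 \<and> b n (Suc m) \<noteq> 0 \<and>
        c n (Suc m) - c n m = d (Suc n) m - d n m \<and>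
        a (Suc n) m + b (Suc n) m - a n (Suc m) - b n (Suc m)
          = (c n m - d n m) * (c n (Suc m) - c n m) \<and>
        a (Suc n) (Suc m) * (c n m - d n m) = a (Suc n) m * (c (Suc n) m - d (Suc n) m) \<and>
        b (Suc n) (Suc m) * (c n m - d n m) = b n (Suc m) * (c n (Suc m) - d n (Suc m)))"

lemma invertible_L_mat_iff:
  "invertible (L_mat \<alpha> n m x) \<longleftrightarrow> \<alpha> 2 n m \<noteq> 0 \<and> \<alpha> 4 (Suc n) m \<noteq> 0"
  by (auto simp: invertible_det_nz det_3 L_mat_def)

lemma invertible_M_mat_iff:
  "invertible (M_mat \<alpha> \<beta> n m x) \<longleftrightarrow> \<alpha> 3 n m \<noteq> 0 \<and> \<alpha> 5 n (Suc m) \<noteq> 0"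
  by (auto simp: invertible_det_nz det_3 M_mat_def)

lemma linear_function_eq_0_iff:
  fixes u v :: complex
  shows "(\<forall>x. u * x + v = 0) \<longleftrightarrow> u = 0 \<and> v = 0"
proof
  assume *: "\<forall>x. u * x + v = 0"
  from *[rule_format, of 0] have "v = 0" by simp
  with *[rule_format, of 1] show "u = 0 \<and> v = 0" by simp
qed simp

text \<open>
  The first two relations are the coefficients of \<open>x\<close> and \<open>1\<close> in the upper left entry. In the rest
  of the first row and of the first column the terms with \<open>x\<close> cancel, and each entry gives one of
  the other relations. The lower right two by two block vanishes identically.
\<close>

lemma zero_curvature_iff:
  "(\<forall>x. L_mat \<alpha> n (m + 1) x ** M_mat \<alpha> \<beta> n m x - M_mat \<alpha> \<beta> (n + 1) m x ** L_mat \<alpha> n m x = 0) \<longleftrightarrow>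
     \<alpha> 1 n (Suc m) + \<beta> n m = \<beta> (Suc n) m + \<alpha> 1 n m \<and>
     \<alpha> 1 n (Suc m) * \<beta> n m + \<alpha> 2 n (Suc m) * \<alpha> 4 n (Suc m) + \<alpha> 3 n (Suc m) * \<alpha> 5 n (Suc m)
       = \<beta> (Suc n) m * \<alpha> 1 n m + \<alpha> 2 (Suc n) m * \<alpha> 4 (Suc n) m
         + \<alpha> 3 (Suc n) m * \<alpha> 5 (Suc n) m \<and>
     \<alpha> 2 n (Suc m) = (\<beta> (Suc n) m - \<alpha> 1 n (Suc m)) * \<alpha> 2 n m \<and>
     \<alpha> 3 (Suc n) m = (\<alpha> 1 n (Suc m) - \<beta> (Suc n) m) * \<alpha> 3 n m \<and>
     \<alpha> 4 (Suc n) m = (\<beta> n m - \<alpha> 1 n m) * \<alpha> 4 (Suc n) (Suc m) \<and>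
     \<alpha> 5 n (Suc m) = (\<alpha> 1 n m - \<beta> n m) * \<alpha> 5 (Suc n) (Suc m)"
    (is "(\<forall>x. ?Z x) \<longleftrightarrow> ?R")
proof -
  let ?E = "\<lambda>x. (\<alpha> 1 n (Suc m) + \<beta> n m - \<beta> (Suc n) m - \<alpha> 1 n m) * x
     + (\<alpha> 1 n (Suc m) * \<beta> n m + \<alpha> 2 n (Suc m) * \<alpha> 4 n (Suc m) + \<alpha> 3 n (Suc m) * \<alpha> 5 n (Suc m)
       - (\<beta> (Suc n) m * \<alpha> 1 n m + \<alpha> 2 (Suc n) m * \<alpha> 4 (Suc n) m
         + \<alpha> 3 (Suc n) m * \<alpha> 5 (Suc n) m))"
  let ?S = "\<alpha> 2 n (Suc m) = (\<beta> (Suc n) m - \<alpha> 1 n (Suc m)) * \<alpha> 2 n m \<and>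
     \<alpha> 3 (Suc n) m = (\<alpha> 1 n (Suc m) - \<beta> (Suc n) m) * \<alpha> 3 n m \<and>
     \<alpha> 4 (Suc n) m = (\<beta> n m - \<alpha> 1 n m) * \<alpha> 4 (Suc n) (Suc m) \<and>
     \<alpha> 5 n (Suc m) = (\<alpha> 1 n m - \<beta> n m) * \<alpha> 5 (Suc n) (Suc m)"
  have Z: "?Z x \<longleftrightarrow> ?E x = 0 \<and> ?S" for x
    by (simp add: vec_eq_iff forall_3 L_mat_def M_mat_def matrix_matrix_mult_def sum_3)
       (auto simp: algebra_simps)
  have "(\<forall>x. ?Z x) \<longleftrightarrow> (\<forall>x. ?E x = 0) \<and> ?S"
    unfolding Z by blast
  then show ?thesis
    unfolding linear_function_eq_0_iff by (auto simp: algebra_simps)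
qed

text \<open>
  Write \<open>\<delta> = c - d\<close>. When \<open>m\<close> increases, \<open>\<alpha>\<^sub>2\<close> gains the factor \<open>\<delta> n m\<close> and \<open>\<alpha>\<^sub>4\<close> loses the factor
  \<open>\<delta> (n-1) m\<close>; the product of both changes is the relation between \<open>a n (m+1)\<close> and \<open>a n m\<close>.
  Conversely one may choose \<open>\<alpha>\<^sub>2\<close> as the product of the values of \<open>\<delta>\<close> below \<open>(n, m)\<close>, which
  determines \<open>\<alpha>\<^sub>4\<close>. For \<open>\<alpha>\<^sub>3\<close>, \<open>\<alpha>\<^sub>5\<close> and \<open>b\<close> the same happens in the other direction, with \<open>- \<delta>\<close>.
\<close>

lemma zero_curvature_iff_compatible:
  assumes a0: "\<And>m. a 0 m = 0" and b0: "\<And>n. b n 0 = 0"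
  shows
    "(\<exists>\<alpha> \<beta>.
        (\<forall>n m x. invertible (L_mat \<alpha> n m x) \<and> invertible (M_mat \<alpha> \<beta> n m x)) \<and>
        (\<forall>n m. c n m = - \<alpha> 1 n m \<and> d n m = - \<beta> n m \<and>
               a n m = - (\<alpha> 4 n m * \<alpha> 2 n m) \<and> b n m = - (\<alpha> 5 n m * \<alpha> 3 n m)) \<and>
        (\<forall>n m x. L_mat \<alpha> n (m + 1) x ** M_mat \<alpha> \<beta> n m x
                 - M_mat \<alpha> \<beta> (n + 1) m x ** L_mat \<alpha> n m x = 0))
     \<longleftrightarrow> compatible a b c d" (is "?A \<longleftrightarrow> _")
proof
  assume ?A
  then obtain \<alpha> \<beta> where
    inv: "\<And>n m. \<alpha> 2 n m \<noteq> 0 \<and> \<alpha> 4 (Suc n) m \<noteq> 0 \<and> \<alpha> 3 n m \<noteq> 0 \<and> \<alpha> 5 n (Suc m) \<noteq> 0"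
    and coeffs: "\<And>n m. c n m = - \<alpha> 1 n m" "\<And>n m. d n m = - \<beta> n m"
      "\<And>n m. a n m = - (\<alpha> 4 n m * \<alpha> 2 n m)" "\<And>n m. b n m = - (\<alpha> 5 n m * \<alpha> 3 n m)"
    and zc: "\<forall>n m x. L_mat \<alpha> n (m + 1) x ** M_mat \<alpha> \<beta> n m x
                 - M_mat \<alpha> \<beta> (n + 1) m x ** L_mat \<alpha> n m x = 0"
    unfolding invertible_L_mat_iff invertible_M_mat_iff by blast
  note zc = zc[unfolded zero_curvature_iff, rule_format]
  have lin: "c n (Suc m) - c n m = d (Suc n) m - d n m" for n m
    using zc[of n m] unfolding coeffs by (auto simp: algebra_simps)
  have step2: "\<alpha> 2 n (Suc m) = (c n m - d n m) * \<alpha> 2 n m" for n m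
  proof -
    have "\<alpha> 2 n (Suc m) = (c n (Suc m) - d (Suc n) m) * \<alpha> 2 n m"
      using zc[of n m] unfolding coeffs by auto
    with lin[of n m] show ?thesis by algebra
  qed
  have step3: "\<alpha> 3 (Suc n) m = (d n m - c n m) * \<alpha> 3 n m" for n m
  proof -
    have "\<alpha> 3 (Suc n) m = (d (Suc n) m - c n (Suc m)) * \<alpha> 3 n m"
      using zc[of n m] unfolding coeffs by auto
    with lin[of n m] show ?thesis by algebra
  qed
  have step4: "\<alpha> 4 (Suc n) m = (c n m - d n m) * \<alpha> 4 (Suc n) (Suc m)" for n m
    using zc[of n m] unfolding coeffs by auto
  have step5: "\<alpha> 5 n (Suc m) = (d n m - c n m) * \<alpha> 5 (Suc n) (Suc m)" for n m
    using zc[of n m] unfolding coeffs by auto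
  show "compatible a b c d"
    unfolding compatible_def
  proof (intro allI conjI)
    fix n m
    show "c n m \<noteq> d n m"
      using step2[of n m] inv[of n "Suc m"] by auto
    show "a (Suc n) m \<noteq> 0" "b n (Suc m) \<noteq> 0"
      using inv[of n m] inv[of "Suc n" m] inv[of n "Suc m"] by (auto simp: coeffs)
    show "c n (Suc m) - c n m = d (Suc n) m - d n m"
      by (rule lin)
    have "c n (Suc m) * d n m - a n (Suc m) - b n (Suc m)
        = d (Suc n) m * c n m - a (Suc n) m - b (Suc n) m"
      using zc[of n m] unfolding coeffs by (auto simp: algebra_simps)
    with lin[of n m] show "a (Suc n) m + b (Suc n) m - a n (Suc m) - b n (Suc m)
        = (c n m - d n m) * (c n (Suc m) - c n m)"
      by algebra
    show "a (Suc n) (Suc m) * (c n m - d n m) = a (Suc n) m * (c (Suc n) m - d (Suc n) m)"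
      unfolding coeffs(3) using step4[of n m] step2[of "Suc n" m] by algebra
    show "b (Suc n) (Suc m) * (c n m - d n m) = b n (Suc m) * (c n (Suc m) - d n (Suc m))"
      unfolding coeffs(4) using step5[of n m] step3[of n "Suc m"] by algebra
  qed
next
  assume "compatible a b c d"
  then have nz: "\<And>n m. c n m \<noteq> d n m" "\<And>n m. a (Suc n) m \<noteq> 0" "\<And>n m. b n (Suc m) \<noteq> 0"
    and lin: "\<And>n m. c n (Suc m) - c n m = d (Suc n) m - d n m"
    and quad: "\<And>n m. a (Suc n) m + b (Suc n) m - a n (Suc m) - b n (Suc m)
        = (c n m - d n m) * (c n (Suc m) - c n m)"
    and ratio_a: "\<And>n m. a (Suc n) (Suc m) * (c n m - d n m)
        = a (Suc n) m * (c (Suc n) m - d (Suc n) m)"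
    and ratio_b: "\<And>n m. b (Suc n) (Suc m) * (c n m - d n m)
        = b n (Suc m) * (c n (Suc m) - d n (Suc m))"
    unfolding compatible_def by auto
  define u where "u n m = (\<Prod>j<m. c n j - d n j)" for n m
  define v where "v n m = (\<Prod>i<n. d i m - c i m)" for n m
  have u: "u n m \<noteq> 0" "u n (Suc m) = (c n m - d n m) * u n m"
    and v: "v n m \<noteq> 0" "v (Suc n) m = (d n m - c n m) * v n m" for n m
    using nz(1) by (auto simp: u_def v_def) (metis nz(1))
  define \<alpha> where "\<alpha> = (\<lambda>(i::nat) n m. if i = 1 then - c n m else if i = 2 then u n m
     else if i = 3 then v n m else if i = 4 then - a n m / u n m else - b n m / v n m)"
  define \<beta> where "\<beta> n m = - d n m" for n m
  have \<alpha>: "\<alpha> 1 n m = - c n m" "\<alpha> 2 n m = u n m" "\<alpha> 3 n m = v n m"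
    "\<alpha> 4 n m = - a n m / u n m" "\<alpha> 5 n m = - b n m / v n m" for n m
    by (simp_all add: \<alpha>_def)
  have prods: "u n m * (- a n m / u n m) = - a n m" "v n m * (- b n m / v n m) = - b n m" for n m
    using u v by simp_all
  have inv: "invertible (L_mat \<alpha> n m x)" "invertible (M_mat \<alpha> \<beta> n m x)" for n m x
    unfolding invertible_L_mat_iff invertible_M_mat_iff \<alpha> using nz u v by auto
  have zc: "\<forall>x. L_mat \<alpha> n (m + 1) x ** M_mat \<alpha> \<beta> n m x
                 - M_mat \<alpha> \<beta> (n + 1) m x ** L_mat \<alpha> n m x = 0" for n m
    unfolding zero_curvature_iff \<alpha> \<beta>_def
  proof (intro conjI)
    show "- c n (Suc m) + - d n m = - d (Suc n) m + - c n m"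
      using lin[of n m] by algebra
    show "- c n (Suc m) * - d n m + u n (Suc m) * (- a n (Suc m) / u n (Suc m))
          + v n (Suc m) * (- b n (Suc m) / v n (Suc m))
        = - d (Suc n) m * - c n m + u (Suc n) m * (- a (Suc n) m / u (Suc n) m)
          + v (Suc n) m * (- b (Suc n) m / v (Suc n) m)"
      unfolding prods using lin[of n m] quad[of n m] by algebra
    show "u n (Suc m) = (- d (Suc n) m - - c n (Suc m)) * u n m"
      using u(2)[of n m] lin[of n m] by algebra
    show "v (Suc n) m = (- c n (Suc m) - - d (Suc n) m) * v n m"
      using v(2)[of n m] lin[of n m] by algebra
    show "- a (Suc n) m / u (Suc n) m
        = (- d n m - - c n m) * (- a (Suc n) (Suc m) / u (Suc n) (Suc m))"
      using u(1)[of "Suc n" m] nz(1)[of "Suc n" m] ratio_a[of n m]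
      by (simp add: u divide_simps) (simp add: algebra_simps)
    show "- b n (Suc m) / v n (Suc m)
        = (- c n m - - d n m) * (- b (Suc n) (Suc m) / v (Suc n) (Suc m))"
      using v(1)[of n "Suc m"] nz(1)[of n "Suc m"] ratio_b[of n m]
      by (simp add: v divide_simps) (simp add: algebra_simps)
  qed
  have "c n m = - \<alpha> 1 n m \<and> d n m = - \<beta> n m \<and>
      a n m = - (\<alpha> 4 n m * \<alpha> 2 n m) \<and> b n m = - (\<alpha> 5 n m * \<alpha> 3 n m)" for n m
    unfolding \<alpha> \<beta>_def using u v by simp
  with inv zc show ?A by blast
qed

section \<open>Compatibility of the two recurrences\<close>

text \<open>
  The left side is the defect of the recurrence in the first direction at \<open>(n, m + 1)\<close>. Expanding
  each value at height \<open>m + 1\<close> by the diagonal step, and using the recurrence at height \<open>m\<close>, brings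
  everything to the values at \<open>(n+1, m)\<close>, \<open>(n, m)\<close>, \<open>(n-1, m)\<close> and \<open>(n, m-1)\<close>. The values of \<open>F\<close>
  are those of a lattice of polynomials at one point \<open>x\<close>. Read in one direction the identity
  constructs the polynomials, read in the other it yields the compatibility relations.
\<close>

lemma recurrence_defect:
  fixes F :: "nat \<Rightarrow> nat \<Rightarrow> complex"
  assumes a0: "\<And>m. a 0 m = 0" and b0: "\<And>n. b n 0 = 0"
    and diag: "\<And>n m. F n (Suc m) = F (Suc n) m + (c n m - d n m) * F n m"
    and rec: "\<And>n. F (Suc n) m = (x - c n m) * F n m - a n m * F (n - 1) m - b n m * F n (m - 1)"
  shows "(x - c n (Suc m)) * F n (Suc m) - a n (Suc m) * F (n - 1) (Suc m) - b n (Suc m) * F n m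
      - F (Suc n) (Suc m)
    = (c n m - d n m - (c n (Suc m) - d (Suc n) m)) * F (Suc n) m
      + (a (Suc n) m + b (Suc n) m - a n (Suc m) - b n (Suc m)
         - (c n m - d n m) * (c n (Suc m) - c n m)) * F n m
      + (a n m * (c n m - d n m) - a n (Suc m) * (c (n - 1) m - d (n - 1) m)) * F (n - 1) m
      + (b n m * (c n m - d n m) - b (Suc n) m * (c n (m - 1) - d n (m - 1))) * F n (m - 1)"
proof -
  \<comment> \<open>The diagonal step fails at a truncated predecessor, but there the coefficient is zero.\<close>
  have A: "a n (Suc m) * F (n - 1) (Suc m)
      = a n (Suc m) * (F n m + (c (n - 1) m - d (n - 1) m) * F (n - 1) m)"
    by (cases n) (simp_all add: a0 diag)
  have B: "b (Suc n) m * F (Suc n) (m - 1)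
      = b (Suc n) m * (F n m - (c n (m - 1) - d n (m - 1)) * F n (m - 1))"
    by (cases m) (simp_all add: b0 diag)
  show ?thesis
    using A B diag[of n m] diag[of "Suc n" m] rec[of n] rec[of "Suc n"] by simp algebra
qed

section \<open>Favard's theorem\<close>

text \<open>
  For monic \<open>p n\<close> of degree \<open>n\<close>, the value \<open>s n\<close> is forced by the values before it and by the
  requirement that the functional vanishes on \<open>p n\<close> for \<open>n > 0\<close>.
\<close>

fun favard_moments :: "(nat \<Rightarrow> complex poly) \<Rightarrow> nat \<Rightarrow> complex" where
  "favard_moments p n =
     (if n = 0 then 1 else - (\<Sum>i<n. coeff (p n) i * favard_moments p i))"

declare favard_moments.simps [simp del]

text \<open>
  The \<open>n\<close>-th moment is included because its nonvanishing is what makes indices normal.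
\<close>

definition orthogonal_exactly :: "(nat \<Rightarrow> complex) \<Rightarrow> nat \<Rightarrow> complex poly \<Rightarrow> bool" where
  "orthogonal_exactly s n p \<longleftrightarrow> (\<forall>k<n. moment s k p = 0) \<and> moment s n p \<noteq> 0"

text \<open>
  The recurrence moves a factor \<open>x\<close> into the index of the polynomial: the \<open>(k+1)\<close>-st moment of
  \<open>p n\<close> is a combination of the \<open>k\<close>-th moments of \<open>p (n+1)\<close>, \<open>p n\<close> and \<open>p (n-1)\<close>. For
  \<open>k + 1 < n\<close> all three vanish; for \<open>k + 1 = n\<close> the last one survives with the factor \<open>a n \<noteq> 0\<close>.
\<close>

lemma favard_functional_exists:
  assumes deg: "\<And>n. degree (p n) = n" and monic: "\<And>n. lead_coeff (p n) = 1"
    and rec: "\<And>n. p (Suc n) = [:- c n, 1:] * p n - smult (a n) (p (n - 1))"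
    and a0: "a 0 = 0" and a_nz: "\<And>n. a (Suc n) \<noteq> 0"
  shows "\<exists>s. \<forall>n. orthogonal_exactly s n (p n)"
proof -
  define s where "s = favard_moments p"
  have mom: "moment s 0 (p n) = (if n = 0 then 1 else 0)" for n
  proof -
    have "moment s 0 (p n) = (\<Sum>i<n. coeff (p n) i * s i) + s n"
      using monic[of n] by (simp add: moment_def deg lessThan_Suc_atMost[symmetric])
    then show ?thesis
      by (simp add: s_def favard_moments.simps[of p n])
  qed
  have shift: "moment s (Suc k) (p n)
      = moment s k (p (Suc n)) + c n * moment s k (p n) + a n * moment s k (p (n - 1))" for n k
    by (simp add: rec)
  have "(\<forall>n. k < n \<longrightarrow> moment s k (p n) = 0) \<and> moment s k (p k) \<noteq> 0" for k
  proof (induction k)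
    case 0
    then show ?case by (simp add: mom)
  next
    case (Suc k)
    then show ?case by (auto simp: shift a_nz)
  qed
  then show ?thesis unfolding orthogonal_exactly_def by blast
qed

section \<open>Orthogonality on the lattice and perfectness\<close>

text \<open>
  Moments of order less than \<open>n\<close> vanish for both summands of the diagonal step. In order \<open>n\<close> the
  first summand still vanishes, since it has one more orthogonality condition, and the second
  contributes the factor \<open>\<delta> n m\<close>. With the roles of \<open>n\<close> and \<open>m\<close> exchanged and \<open>\<delta>\<close> negated this
  also serves the second functional.
\<close>

lemma orthogonal_on_grid:
  assumes diag: "\<And>n m. P n (Suc m) = P (Suc n) m + smult (\<delta> n m) (P n m)"
    and nz: "\<And>n m. \<delta> n m \<noteq> 0"
    and base: "\<And>n. orthogonal_exactly s n (P n 0)"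
  shows "orthogonal_exactly s n (P n m)"
proof (induction m arbitrary: n)
  case 0
  then show ?case by (rule base)
next
  case (Suc m)
  from Suc[of n] Suc[of "Suc n"] show ?case
    by (auto simp: orthogonal_exactly_def diag nz)
qed

text \<open>
  Subtracting the multiple of \<open>P n m\<close> that cancels the top coefficient leaves a solution \<open>R\<close> of
  smaller degree. It is also a solution for a neighbouring index with sum \<open>n + m - 1\<close>, hence a
  multiple of the polynomial there; but that polynomial has a nonzero moment in the one order in
  which \<open>R\<close> satisfies an additional condition. So \<open>R = 0\<close>.
\<close>

lemma orthogonal_polynomial_unique:
  assumes deg: "\<And>n m. degree (P n m) = n + m" and monic: "\<And>n m. lead_coeff (P n m) = 1"
    and orth: "\<And>n m. orthogonal_exactly s1 n (P n m)" "\<And>n m. orthogonal_exactly s2 m (P n m)"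
    and Q: "degree Q \<le> n + m" "\<And>k. k < n \<Longrightarrow> moment s1 k Q = 0" "\<And>k. k < m \<Longrightarrow> moment s2 k Q = 0"
  shows "Q = smult (coeff Q (n + m)) (P n m)"
  using Q
proof (induction "n + m" arbitrary: n m Q)
  case 0
  then have "degree Q = 0" "degree (P n m) = 0" by (auto simp: deg)
  with 0 monic[of n m] show ?case
    by (auto elim!: degree_eq_zeroE)
next
  case (Suc N)
  define R where "R = Q - smult (coeff Q (n + m)) (P n m)"
  have R_deg: "degree R \<le> N"
  proof (rule degree_le, intro allI impI)
    fix i assume "N < i"
    show "coeff R i = 0"
    proof (cases "i = n + m")
      case True
      with monic[of n m] show ?thesis by (simp add: R_def deg)
    next
      case False
      with \<open>N < i\<close> Suc.hyps(2) have "n + m < i" by simp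
      with Suc.prems(1) show ?thesis by (simp add: R_def coeff_eq_0 deg)
    qed
  qed
  have R1: "moment s1 k R = 0" if "k < n" for k
    using that Suc.prems(2) orth(1)[of n m] by (simp add: R_def orthogonal_exactly_def)
  have R2: "moment s2 k R = 0" if "k < m" for k
    using that Suc.prems(3) orth(2)[of m n] by (simp add: R_def orthogonal_exactly_def)
  have "R = 0"
  proof (cases n)
    case (Suc n')
    with Suc.hyps(2) have N: "N = n' + m" by simp
    have R: "R = smult (coeff R N) (P n' m)"
      using Suc.hyps(1)[OF N, of R] R_deg R1 R2 Suc N by simp
    then have "moment s1 n' R = coeff R N * moment s1 n' (P n' m)"
      by (metis moment_smult)
    with R1[of n'] Suc orth(1)[of n' m] have "coeff R N = 0"
      by (simp add: orthogonal_exactly_def)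
    with R show ?thesis by simp
  next
    case 0
    with Suc.hyps(2) obtain m' where m': "m = Suc m'" and N: "N = n + m'" by auto
    have R: "R = smult (coeff R N) (P n m')"
      using Suc.hyps(1)[OF N, of R] R_deg R1 R2 m' N by simp
    then have "moment s2 m' R = coeff R N * moment s2 m' (P n m')"
      by (metis moment_smult)
    with R2[of m'] m' orth(2)[of m' n] have "coeff R N = 0"
      by (simp add: orthogonal_exactly_def)
    with R show ?thesis by simp
  qed
  then show ?case by (simp add: R_def)
qed

lemma perfect_system_if_orthogonal:
  assumes deg: "\<And>n m. degree (P n m) = n + m" and monic: "\<And>n m. lead_coeff (P n m) = 1"
    and orth: "\<And>n m. orthogonal_exactly s1 n (P n m)" "\<And>n m. orthogonal_exactly s2 m (P n m)"
  defines "f1 \<equiv> series_at_infinity s1" and "f2 \<equiv> series_at_infinity s2"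
  shows "hermite_pade f1 f2 n m (P n m)" and "perfect_system f1 f2"
proof -
  show hp: "hermite_pade f1 f2 n m (P n m)" for n m
    using orth(1)[of n m] orth(2)[of m n] monic[of n m] deg[of n m]
    unfolding f1_def f2_def hermite_pade_iff_orthogonal by (auto simp: orthogonal_exactly_def)
  have unique: "Q = smult (coeff Q (n + m)) (P n m)" "coeff Q (n + m) \<noteq> 0"
    if "hermite_pade f1 f2 n m Q" for n m Q
  proof -
    from that have "Q \<noteq> 0" "degree Q \<le> n + m"
      "\<And>k. k < n \<Longrightarrow> moment s1 k Q = 0" "\<And>k. k < m \<Longrightarrow> moment s2 k Q = 0"
      unfolding f1_def f2_def hermite_pade_iff_orthogonal by auto
    with orthogonal_polynomial_unique[of P s1 s2 Q n m, OF deg monic orth]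
    show *: "Q = smult (coeff Q (n + m)) (P n m)" by blast
    with \<open>Q \<noteq> 0\<close> show "coeff Q (n + m) \<noteq> 0" by auto
  qed
  show "perfect_system f1 f2"
    unfolding perfect_system_def normal_index_def
  proof (intro allI conjI impI)
    fix n m
    show "\<exists>P. hermite_pade f1 f2 n m P" using hp by blast
  next
    fix n m Q Q' assume "hermite_pade f1 f2 n m Q \<and> hermite_pade f1 f2 n m Q'"
    then have Q: "Q = smult (coeff Q (n + m)) (P n m)" "coeff Q (n + m) \<noteq> 0"
      and Q': "Q' = smult (coeff Q' (n + m)) (P n m)"
      using unique by blast+
    let ?k = "coeff Q' (n + m) / coeff Q (n + m)"
    have "smult ?k Q = smult ?k (smult (coeff Q (n + m)) (P n m))"
      using Q(1) by simp
    with Q(2) Q' have "Q' = smult ?k Q" by simp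
    then show "\<exists>k. Q' = smult k Q" ..
  next
    fix n m Q assume "hermite_pade f1 f2 n m Q"
    from unique[OF this] show "degree Q = n + m"
      by (metis deg degree_smult_eq)
  qed
qed

section \<open>From compatible coefficients to a perfect system\<close>

text \<open>
  The predecessor in the second equation is truncated, which has no effect for \<open>a 0 = 0\<close>.
\<close>

fun monic_row :: "(nat \<Rightarrow> complex) \<Rightarrow> (nat \<Rightarrow> complex) \<Rightarrow> nat \<Rightarrow> complex poly" where
  "monic_row c a 0 = 1"
| "monic_row c a (Suc n) = [:- c n, 1:] * monic_row c a n - smult (a n) (monic_row c a (n - 1))"

text \<open>
  Only the diagonal step is built in; that the recurrences hold above the row \<open>m = 0\<close> is what
  compatibility guarantees.
\<close>

fun monic_grid ::
  "(nat \<Rightarrow> nat \<Rightarrow> complex) \<Rightarrow> (nat \<Rightarrow> nat \<Rightarrow> complex) \<Rightarrow> (nat \<Rightarrow> nat \<Rightarrow> complex) \<Rightarrow>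
    nat \<Rightarrow> nat \<Rightarrow> complex poly" where
  "monic_grid a c d n 0 = monic_row (\<lambda>n. c n 0) (\<lambda>n. a n 0) n"
| "monic_grid a c d n (Suc m)
     = monic_grid a c d (Suc n) m + smult (c n m - d n m) (monic_grid a c d n m)"

lemma monic_add_lower:
  fixes p q :: "complex poly"
  assumes "degree q < degree p" and "lead_coeff p = 1"
  shows "degree (p + q) = degree p" and "lead_coeff (p + q) = 1"
  using assms by (auto simp: degree_add_eq_left coeff_eq_0)

lemma monic_row_monic: "degree (monic_row c a n) = n \<and> lead_coeff (monic_row c a n) = 1"
proof (induction n rule: less_induct)
  case (less n)
  show ?case
  proof (cases n)
    case 0
    then show ?thesis by simp
  next
    case (Suc k)
    let ?p = "[:- c k, 1:] * monic_row c a k" and ?q = "smult (- a k) (monic_row c a (k - 1))"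
    from less.IH[of k] Suc have k: "degree (monic_row c a k) = k" "lead_coeff (monic_row c a k) = 1"
      by auto
    then have nz: "monic_row c a k \<noteq> 0" by auto
    have p: "degree ?p = Suc k"
      using degree_mult_eq[of "[:- c k, 1:]", OF _ nz] k by (simp del: mult_pCons_left)
    have lead: "lead_coeff ?p = 1"
      unfolding lead_coeff_mult using k by simp
    have "degree ?q \<le> k - 1"
      using less.IH[of "k - 1"] Suc degree_smult_le[of "- a k" "monic_row c a (k - 1)"] by simp
    with p have "degree ?q < degree ?p" by linarith
    note monic_add_lower[OF this lead, unfolded p]
    moreover have "monic_row c a n = ?p + ?q" by (simp add: Suc)
    ultimately show ?thesis using Suc by metis
  qed
qed

lemma monic_grid_monic:
  "degree (monic_grid a c d n m) = n + m \<and> lead_coeff (monic_grid a c d n m) = 1"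
proof (induction m arbitrary: n)
  case 0
  then show ?case
    by (metis add_0_right monic_grid.simps(1) monic_row_monic)
next
  case (Suc m)
  let ?q = "smult (c n m - d n m) (monic_grid a c d n m)"
  have "degree ?q < degree (monic_grid a c d (Suc n) m)"
    using Suc.IH[of n] Suc.IH[of "Suc n"] degree_smult_le[of "c n m - d n m" "monic_grid a c d n m"]
    by simp
  from monic_add_lower[OF this] Suc.IH[of "Suc n"] show ?case
    by (metis add_Suc_shift monic_grid.simps(2))
qed

text \<open>
  Induction on \<open>m\<close>: compatibility makes all four coefficients in \<open>recurrence_defect\<close> zero. The
  second recurrence is the first one plus the diagonal step.
\<close>

lemma monic_grid_recurrences:
  assumes a0: "\<And>m. a 0 m = 0" and b0: "\<And>n. b n 0 = 0" and comp: "compatible a b c d"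
  shows "nearest_neighbour_recurrences a b c d (monic_grid a c d)"
proof -
  let ?P = "monic_grid a c d"
  have rec: "poly (?P (Suc n) m) x = (x - c n m) * poly (?P n m) x
      - a n m * poly (?P (n - 1) m) x - b n m * poly (?P n (m - 1)) x" for n m x
  proof (induction m arbitrary: n)
    case 0
    then show ?case by (simp add: b0 algebra_simps)
  next
    case (Suc m)
    note C = comp[unfolded compatible_def, rule_format]
    have "a n m * (c n m - d n m) = a n (Suc m) * (c (n - 1) m - d (n - 1) m)"
      using C[of "n - 1" m] by (cases n) (auto simp: a0)
    moreover have "b n m * (c n m - d n m) = b (Suc n) m * (c n (m - 1) - d n (m - 1))"
      using C[of n "m - 1"] by (cases m) (auto simp: b0)
    moreover have "c n m - d n m = c n (Suc m) - d (Suc n) m"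
      using C[of n m] by (auto simp: algebra_simps)
    moreover have "a (Suc n) m + b (Suc n) m - a n (Suc m) - b n (Suc m)
        = (c n m - d n m) * (c n (Suc m) - c n m)"
      using C[of n m] by blast
    ultimately show ?case
      using recurrence_defect[of a b "\<lambda>n m. poly (?P n m) x" c d m x n, OF a0 b0 _ Suc.IH] by simp
  qed
  then show ?thesis
    unfolding nearest_neighbour_recurrences_def by (auto simp: algebra_simps)
qed

text \<open>
  On the row \<open>m = 0\<close> the terms with \<open>b\<close> disappear, and on the column \<open>n = 0\<close> those with \<open>a\<close>. Both
  boundary sequences thus satisfy three-term recurrences with nonzero coefficients, to which
  Favard's theorem applies.
\<close>

lemma monic_grid_perfect:
  assumes a0: "\<And>m. a 0 m = 0" and b0: "\<And>n. b n 0 = 0" and comp: "compatible a b c d"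
  shows "\<exists>s1 s2. perfect_system (series_at_infinity s1) (series_at_infinity s2) \<and>
    (\<forall>n m. hermite_pade (series_at_infinity s1) (series_at_infinity s2) n m (monic_grid a c d n m))"
proof -
  let ?P = "monic_grid a c d"
  have nz: "\<And>n m. c n m - d n m \<noteq> 0" "\<And>n m. d n m - c n m \<noteq> 0"
    "\<And>n m. a (Suc n) m \<noteq> 0" "\<And>n m. b n (Suc m) \<noteq> 0"
    using comp unfolding compatible_def right_minus_eq by metis+
  have monic: "degree (?P n m) = n + m" "lead_coeff (?P n m) = 1" for n m
    using monic_grid_monic by blast+
  have column: "?P 0 (Suc m) = [:- d 0 m, 1:] * ?P 0 m - smult (b 0 m) (?P 0 (m - 1))" for m
    unfolding poly_eq_poly_eq_iff[symmetric]
  proof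
    fix x
    have "poly (?P 0 (Suc m)) x = (x - d 0 m) * poly (?P 0 m) x - b 0 m * poly (?P 0 (m - 1)) x"
      using monic_grid_recurrences[OF assms] unfolding nearest_neighbour_recurrences_def
      by (simp add: a0 del: monic_grid.simps)
    then show "poly (?P 0 (Suc m)) x
        = poly ([:- d 0 m, 1:] * ?P 0 m - smult (b 0 m) (?P 0 (m - 1))) x"
      by (simp add: algebra_simps del: monic_grid.simps)
  qed
  have "\<exists>s1. \<forall>n. orthogonal_exactly s1 n (?P n 0)"
    by (rule favard_functional_exists[of _ "\<lambda>n. c n 0" "\<lambda>n. a n 0"]) (use monic[of _ 0] a0 nz in simp_all)
  then obtain s1 where s1: "\<And>n. orthogonal_exactly s1 n (?P n 0)" by blast
  have "\<exists>s2. \<forall>m. orthogonal_exactly s2 m (?P 0 m)"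
    by (rule favard_functional_exists[of _ "d 0" "b 0"]) (use monic[of 0] column b0 nz in simp_all)
  then obtain s2 where s2: "\<And>m. orthogonal_exactly s2 m (?P 0 m)" by blast
  have orth1: "orthogonal_exactly s1 n (?P n m)" for n m
    by (rule orthogonal_on_grid[where \<delta> = "\<lambda>n m. c n m - d n m"]) (use nz s1 in simp_all)
  have orth2: "orthogonal_exactly s2 m (?P n m)" for n m
    by (rule orthogonal_on_grid[where P = "\<lambda>m n. ?P n m" and \<delta> = "\<lambda>m n. d n m - c n m"])
       (use nz s2 in \<open>simp_all add: smult_diff_left\<close>)
  from perfect_system_if_orthogonal[of ?P s1 s2, OF monic orth1 orth2] show ?thesis by blast
qed

section \<open>From a perfect system to compatible coefficients\<close>

text \<open>
  All four coefficients in \<open>recurrence_defect\<close> must vanish since, away from the boundary of the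
  lattice, the polynomials are linearly independent: two have degrees \<open>n + m + 1\<close> and \<open>n + m\<close>, and the two of degree \<open>n + m - 1\<close>
  differ by a nonzero multiple of a polynomial of degree \<open>n + m - 2\<close>.
\<close>

lemma recurrences_imp_compatible:
  assumes a0: "\<And>m. a 0 m = 0" and b0: "\<And>n. b n 0 = 0"
    and perfect: "perfect_system (series_at_infinity s1) (series_at_infinity s2)"
    and hp: "\<And>n m. hermite_pade (series_at_infinity s1) (series_at_infinity s2) n m (P n m)"
    and monic: "\<And>n m. lead_coeff (P n m) = 1"
    and rec: "nearest_neighbour_recurrences a b c d P"
    and a_nz: "\<And>n m. a (Suc n) m \<noteq> 0" and b_nz: "\<And>n m. b n (Suc m) \<noteq> 0"
  shows "compatible a b c d"
proof -
  define \<delta> where "\<delta> n m = c n m - d n m" for n m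
  have deg: "degree (P n m) = n + m" for n m
    using perfect hp unfolding perfect_system_def normal_index_def by blast
  have lead: "coeff (P n m) (n + m) = 1" for n m
    using monic[of n m] by (simp add: deg)
  have rec1: "poly (P (Suc n) m) x = (x - c n m) * poly (P n m) x
      - a n m * poly (P (n - 1) m) x - b n m * poly (P n (m - 1)) x"
    and rec2: "poly (P n (Suc m)) x = (x - d n m) * poly (P n m) x
      - a n m * poly (P (n - 1) m) x - b n m * poly (P n (m - 1)) x" for n m x
    using rec unfolding nearest_neighbour_recurrences_def by simp_all
  have diag_poly: "poly (P n (Suc m)) x = poly (P (Suc n) m) x + \<delta> n m * poly (P n m) x" for n m x
    unfolding rec1 rec2 \<delta>_def by algebra
  have diag: "P n (Suc m) = P (Suc n) m + smult (\<delta> n m) (P n m)" for n m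
    unfolding poly_eq_poly_eq_iff[symmetric] by (auto simp: fun_eq_iff diag_poly)
  have \<delta>_nz: "\<delta> n m \<noteq> 0" for n m
  proof
    assume "\<delta> n m = 0"
    then have eq: "P n (Suc m) = P (Suc n) m" by (simp add: diag)
    \<comment> \<open>As \<open>P (n+1) m\<close> it has the orthogonality for the first series, as \<open>P n (m+1)\<close> that for the
      second.\<close>
    have "hermite_pade (series_at_infinity s1) (series_at_infinity s2) (Suc n) (Suc m) (P (Suc n) m)"
      using hp[of "Suc n" m] hp[of n "Suc m"] unfolding eq hermite_pade_iff_orthogonal by auto
    then have "degree (P (Suc n) m) = Suc n + Suc m"
      using perfect unfolding perfect_system_def normal_index_def by blast
    then show False by (simp add: deg)
  qed
  have vanish: "\<delta> n m - (c n (Suc m) - d (Suc n) m) = 0 \<and>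
      a (Suc n) m + b (Suc n) m - a n (Suc m) - b n (Suc m) - \<delta> n m * (c n (Suc m) - c n m) = 0 \<and>
      a n m * \<delta> n m - a n (Suc m) * \<delta> (n - 1) m = 0 \<and>
      b n m * \<delta> n m - b (Suc n) m * \<delta> n (m - 1) = 0"
    (is "?u = 0 \<and> ?v = 0 \<and> ?p = 0 \<and> ?q = 0") for n m
  proof -
    have "?u * poly (P (Suc n) m) x + ?v * poly (P n m) x
        + ?p * poly (P (n - 1) m) x + ?q * poly (P n (m - 1)) x = 0" for x
      using recurrence_defect[of a b "\<lambda>n m. poly (P n m) x" c d m x n, OF a0 b0 _ rec1]
        diag_poly[unfolded \<delta>_def] rec1[of n "Suc m" x]
      by (simp add: \<delta>_def)
    then have "smult ?u (P (Suc n) m) + smult ?v (P n m)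
        + smult ?p (P (n - 1) m) + smult ?q (P n (m - 1)) = 0" (is "?lhs = 0")
      unfolding poly_eq_poly_eq_iff[symmetric] by (simp add: fun_eq_iff)
    then have co: "?u * coeff (P (Suc n) m) i + ?v * coeff (P n m) i
        + ?p * coeff (P (n - 1) m) i + ?q * coeff (P n (m - 1)) i = 0" for i
      by (metis coeff_0 coeff_add coeff_smult)
    have p0: "?p = 0" if "n = 0" using that by (simp add: a0)
    have q0: "?q = 0" if "m = 0" using that by (simp add: b0)
    \<comment> \<open>For \<open>n = 0\<close> the truncated predecessor has too large a degree, but its coefficient is zero.\<close>
    have p_high: "?p * coeff (P (n - 1) m) i = 0" if "n + m \<le> i" for i
      using that p0 by (cases "n = 0") (auto intro!: coeff_eq_0 simp: deg)
    have q_high: "?q * coeff (P n (m - 1)) i = 0" if "n + m \<le> i" for i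
      using that q0 by (cases "m = 0") (auto intro!: coeff_eq_0 simp: deg)
    have lead1: "coeff (P (Suc n) m) (Suc (n + m)) = 1"
      using lead[of "Suc n" m] by simp
    have high: "coeff (P n m) (Suc (n + m)) = 0"
      by (rule coeff_eq_0) (simp add: deg)
    have u: "?u = 0"
      using co[of "Suc (n + m)"] lead1 high
        p_high[OF le_SucI[OF order_refl]] q_high[OF le_SucI[OF order_refl]] by algebra
    have v: "?v = 0"
      using co[of "n + m"] u lead[of n m] p_high[OF order_refl] q_high[OF order_refl] by algebra
    have pq: "?p * coeff (P (n - 1) m) i + ?q * coeff (P n (m - 1)) i = 0" for i
      using co[of i] u v by algebra
    have "?p = 0 \<and> ?q = 0"
    proof (cases "n = 0 \<or> m = 0")
      case True
      then show ?thesis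
        using pq[of "n + m - 1"] lead[of "n - 1" m] lead[of n "m - 1"] p0 q0
        by (cases n; cases m) auto
    next
      case False
      then obtain n' m' where nm: "n = Suc n'" "m = Suc m'"
        by (meson not0_implies_Suc)
      have sum0: "?p + ?q = 0"
        using pq[of "n' + m' + 1"] lead[of n' m] lead[of n m'] by (simp add: nm)
      have "?p * \<delta> n' m' * coeff (P n' m') (n' + m') = 0"
      proof -
        have "coeff (P n' m) (n' + m') = coeff (P n m') (n' + m') + \<delta> n' m' * coeff (P n' m') (n' + m')"
          by (simp add: nm diag)
        with pq[of "n' + m'"] sum0 show ?thesis unfolding nm diff_Suc_1 by algebra
      qed
      with lead[of n' m'] \<delta>_nz[of n' m'] have "?p = 0" by simp
      with sum0 show ?thesis by simp
    qed
    with u v show ?thesis by blast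
  qed
  show ?thesis
    unfolding compatible_def
  proof (intro allI conjI)
    fix n m
    show "c n m \<noteq> d n m" using \<delta>_nz[of n m] by (simp add: \<delta>_def)
    show "a (Suc n) m \<noteq> 0" "b n (Suc m) \<noteq> 0" by (fact a_nz b_nz)+
    show "c n (Suc m) - c n m = d (Suc n) m - d n m"
      using vanish[of n m] unfolding \<delta>_def by algebra
    show "a (Suc n) m + b (Suc n) m - a n (Suc m) - b n (Suc m)
        = (c n m - d n m) * (c n (Suc m) - c n m)"
      using vanish[of n m] unfolding \<delta>_def by simp
    show "a (Suc n) (Suc m) * (c n m - d n m) = a (Suc n) m * (c (Suc n) m - d (Suc n) m)"
      using conjunct1[OF conjunct2[OF conjunct2[OF vanish[of "Suc n" m]]]]
      unfolding \<delta>_def by simp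
    show "b (Suc n) (Suc m) * (c n m - d n m) = b n (Suc m) * (c n (Suc m) - d n (Suc m))"
      using conjunct2[OF conjunct2[OF conjunct2[OF vanish[of n "Suc m"]]]]
      unfolding \<delta>_def by simp
  qed
qed

theorem theorem1p1:
  fixes a b c d :: "nat \<Rightarrow> nat \<Rightarrow> complex"
  assumes "\<And>m. a 0 m = 0" and "\<And>n. b n 0 = 0"
  shows
    "(\<exists>\<alpha> \<beta>.
        (\<forall>n m x. invertible (L_mat \<alpha> n m x) \<and> invertible (M_mat \<alpha> \<beta> n m x)) \<and>
        (\<forall>n m. c n m = - \<alpha> 1 n m \<and> d n m = - \<beta> n m \<and>
               a n m = - (\<alpha> 4 n m * \<alpha> 2 n m) \<and> b n m = - (\<alpha> 5 n m * \<alpha> 3 n m)) \<and>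
        (\<forall>n m x. L_mat \<alpha> n (m + 1) x ** M_mat \<alpha> \<beta> n m x
                 - M_mat \<alpha> \<beta> (n + 1) m x ** L_mat \<alpha> n m x = 0))
     \<longleftrightarrow>
     (\<exists>s1 s2 P.
        perfect_system (series_at_infinity s1) (series_at_infinity s2) \<and>
        (\<forall>n m. hermite_pade (series_at_infinity s1) (series_at_infinity s2) n m (P n m) \<and>
               lead_coeff (P n m) = 1) \<and>
        nearest_neighbour_recurrences a b c d P \<and>
        (\<forall>n m. n \<ge> 1 \<longrightarrow> a n m \<noteq> 0) \<and>
        (\<forall>n m. m \<ge> 1 \<longrightarrow> b n m \<noteq> 0))"
  unfolding zero_curvature_iff_compatible[of a b c d, OF assms]
proof
  assume comp: "compatible a b c d"
  then have "\<forall>n m. n \<ge> 1 \<longrightarrow> a n m \<noteq> 0" "\<forall>n m. m \<ge> 1 \<longrightarrow> b n m \<noteq> 0"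
    unfolding compatible_def by (metis One_nat_def Suc_le_D)+
  with monic_grid_perfect[OF assms comp] monic_grid_recurrences[OF assms comp]
    monic_grid_monic[of a c d]
  show "\<exists>s1 s2 P.
      perfect_system (series_at_infinity s1) (series_at_infinity s2) \<and>
      (\<forall>n m. hermite_pade (series_at_infinity s1) (series_at_infinity s2) n m (P n m) \<and>
             lead_coeff (P n m) = 1) \<and>
      nearest_neighbour_recurrences a b c d P \<and>
      (\<forall>n m. n \<ge> 1 \<longrightarrow> a n m \<noteq> 0) \<and>
      (\<forall>n m. m \<ge> 1 \<longrightarrow> b n m \<noteq> 0)"
    by blast
next
  assume "\<exists>s1 s2 P.
      perfect_system (series_at_infinity s1) (series_at_infinity s2) \<and>
      (\<forall>n m. hermite_pade (series_at_infinity s1) (series_at_infinity s2) n m (P n m) \<and>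
             lead_coeff (P n m) = 1) \<and>
      nearest_neighbour_recurrences a b c d P \<and>
      (\<forall>n m. n \<ge> 1 \<longrightarrow> a n m \<noteq> 0) \<and>
      (\<forall>n m. m \<ge> 1 \<longrightarrow> b n m \<noteq> 0)"
  then show "compatible a b c d"
    by (elim exE conjE) (rule recurrences_imp_compatible[of a b, OF assms], auto)
qed

end
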